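(* For any fixed positive integer $M$, $$\mathbf{B}(x)\mathbf{B}(y)=\mathbf{B}(y)\mathbf{B}(x),\qquad \mathbf{C}(x)\mathbf{C}(y)=\mathbf{C}(y)\mathbf{C}(x).$$
   Context: $b(i),c(i)$ ($i\in\mathbb Z$) satisfy $\{b(i),c(j)\}=\delta_{i,-j}$, $\{b(i),b(j)\}=\{c(i),c(j)\}=0$, where $\{A,B\}=AB+BA$. They act on the Fock space $\mathcal F$ generated by $|0\rangle$ with $b(m+1)|0\rangle=c(m)|0\rangle=0$ for $m\ge 0$ (and from the right on the dual Fock space generated by $\langle 0|$ with $\langle 0|b(i+1)=\langle 0|c(i)=0$ for $i<0$). For a fixed positive integer $M$, $$\mathbf B(x)=\exp(x\,b(-M+1)c(M-2))\exp(x\,b(-M+2)c(M-3))\cdots,$$ the ordered product of $\exp(x\,b(-(i-1))c(i-2))$, $i\le M$, with $i$ decreasing from left to right, and $$\mathbf C(x)=\cdots\exp(x\,b(-M+3)c(M-2))\exp(x\,b(-M+2)c(M-1)),$$ the ordered product of $\exp(x\,b(-i+2)c(i-1))$, $i\le M$, with $i$ decreasing from right to left. On each fixed vector all but finitely many factors act as the identity. *)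

theory Defs
  imports Complex_Main "HOL-Library.Groups_Big_Fun"
begin

text \<open>
  A vector space on which the fermion modes act. The relations involve anticommutators only,
  so they are unchanged when products are read in the opposite order. The same locale therefore
  describes left modules, where \<open>b i v\<close> is \<open>b(i)|v\<rangle>\<close>, and right modules, where \<open>b i w\<close> is
  \<open>\<langle>w|b(i)\<close>.
\<close>

locale fermion_module = vector_space scale
  for scale :: "'a::field_char_0 \<Rightarrow> 'v::ab_group_add \<Rightarrow> 'v" +
  fixes b c :: "int \<Rightarrow> 'v \<Rightarrow> 'v"
  assumes linear_b: "Vector_Spaces.linear scale scale (b i)"
    and linear_c: "Vector_Spaces.linear scale scale (c i)"
    and anticomm_bc: "b i (c j v) + c j (b i v) = (if i = - j then v else 0)"
    and anticomm_bb: "b i (b j v) + b j (b i v) = 0"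
    and anticomm_cc: "c i (c j v) + c j (c i v) = 0"

text \<open>
  The last assumption says that the vacuum generates the module. Together with \<open>vac \<noteq> 0\<close>, the
  assumptions determine the module up to isomorphism.
\<close>

locale fock_space = fermion_module scale b c
  for scale :: "'a::field_char_0 \<Rightarrow> 'v::ab_group_add \<Rightarrow> 'v" and b c +
  fixes vac :: 'v
  assumes vac_nonzero: "vac \<noteq> 0"
    and b_vac: "m \<ge> 0 \<Longrightarrow> b (m + 1) vac = 0"
    and c_vac: "m \<ge> 0 \<Longrightarrow> c m vac = 0"
    and vac_generates: "subspace S \<Longrightarrow> vac \<in> S \<Longrightarrow>
      (\<And>i v. v \<in> S \<Longrightarrow> b i v \<in> S) \<Longrightarrow> (\<And>i v. v \<in> S \<Longrightarrow> c i v \<in> S) \<Longrightarrow> S = UNIV"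

text \<open>Here \<open>b i\<close> and \<open>c i\<close> are the right actions.\<close>

locale dual_fock_space = fermion_module scale b c
  for scale :: "'a::field_char_0 \<Rightarrow> 'w::ab_group_add \<Rightarrow> 'w" and b c +
  fixes covac :: 'w
  assumes covac_nonzero: "covac \<noteq> 0"
    and covac_b: "i < 0 \<Longrightarrow> b (i + 1) covac = 0"
    and covac_c: "i < 0 \<Longrightarrow> c i covac = 0"
    and covac_generates: "subspace S \<Longrightarrow> covac \<in> S \<Longrightarrow>
      (\<And>i w. w \<in> S \<Longrightarrow> b i w \<in> S) \<Longrightarrow> (\<And>i w. w \<in> S \<Longrightarrow> c i w \<in> S) \<Longrightarrow> S = UNIV"

text \<open>
  The exponential series of a locally nilpotent operator: applied to a fixed vector, it has only
  finitely many nonzero terms.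
\<close>

definition op_exp ::
  "('a::field_char_0 \<Rightarrow> 'v::ab_group_add \<Rightarrow> 'v) \<Rightarrow> ('v \<Rightarrow> 'v) \<Rightarrow> 'v \<Rightarrow> 'v" where
  "op_exp scale A v = Sum_any (\<lambda>n. scale (1 / fact n) ((A ^^ n) v))"

text \<open>\<open>prod_desc f M N = f M \<circ> f (M - 1) \<circ> \<dots> \<circ> f (M - N + 1)\<close>\<close>

primrec prod_desc :: "(int \<Rightarrow> 'v \<Rightarrow> 'v) \<Rightarrow> int \<Rightarrow> nat \<Rightarrow> 'v \<Rightarrow> 'v" where
  "prod_desc f M 0 = id"
| "prod_desc f M (Suc N) = prod_desc f M N \<circ> f (M - int N)"

text \<open>\<open>prod_asc f M N = f (M - N + 1) \<circ> \<dots> \<circ> f (M - 1) \<circ> f M\<close>\<close>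

primrec prod_asc :: "(int \<Rightarrow> 'v \<Rightarrow> 'v) \<Rightarrow> int \<Rightarrow> nat \<Rightarrow> 'v \<Rightarrow> 'v" where
  "prod_asc f M 0 = id"
| "prod_asc f M (Suc N) = f (M - int N) \<circ> prod_asc f M N"

text \<open>
  An infinite ordered product is evaluated on a fixed vector, where its partial products are
  eventually constant.
\<close>

definition eventual_value :: "(nat \<Rightarrow> 'v) \<Rightarrow> 'v" where
  "eventual_value s = (THE u. \<forall>\<^sub>F N in sequentially. s N = u)"

definition op_B :: "('a::field_char_0 \<Rightarrow> 'v::ab_group_add \<Rightarrow> 'v) \<Rightarrow> (int \<Rightarrow> 'v \<Rightarrow> 'v)
    \<Rightarrow> (int \<Rightarrow> 'v \<Rightarrow> 'v) \<Rightarrow> int \<Rightarrow> 'a \<Rightarrow> 'v \<Rightarrow> 'v" where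
  "op_B scale b c M x v = eventual_value (\<lambda>N.
     prod_desc (\<lambda>i. op_exp scale (\<lambda>u. scale x (b (- (i - 1)) (c (i - 2) u)))) M N v)"

definition op_C :: "('a::field_char_0 \<Rightarrow> 'v::ab_group_add \<Rightarrow> 'v) \<Rightarrow> (int \<Rightarrow> 'v \<Rightarrow> 'v)
    \<Rightarrow> (int \<Rightarrow> 'v \<Rightarrow> 'v) \<Rightarrow> int \<Rightarrow> 'a \<Rightarrow> 'v \<Rightarrow> 'v" where
  "op_C scale b c M x v = eventual_value (\<lambda>N.
     prod_asc (\<lambda>i. op_exp scale (\<lambda>u. scale x (b (- i + 2) (c (i - 1) u)))) M N v)"

text \<open>
  The right actions \<open>\<langle>w| \<mapsto> \<langle>w|B(x)\<close> and \<open>\<langle>w| \<mapsto> \<langle>w|C(x)\<close>. A product acts from the right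
  by its leftmost factor first, so every composition is reversed: in each exponent \<open>b\<close> is applied
  before \<open>c\<close>, and \<open>prod_desc\<close> and \<open>prod_asc\<close> are interchanged.
\<close>

definition op_B_right :: "('a::field_char_0 \<Rightarrow> 'w::ab_group_add \<Rightarrow> 'w) \<Rightarrow> (int \<Rightarrow> 'w \<Rightarrow> 'w)
    \<Rightarrow> (int \<Rightarrow> 'w \<Rightarrow> 'w) \<Rightarrow> int \<Rightarrow> 'a \<Rightarrow> 'w \<Rightarrow> 'w" where
  "op_B_right scale b c M x w = eventual_value (\<lambda>N.
     prod_asc (\<lambda>i. op_exp scale (\<lambda>u. scale x (c (i - 2) (b (- (i - 1)) u)))) M N w)"

definition op_C_right :: "('a::field_char_0 \<Rightarrow> 'w::ab_group_add \<Rightarrow> 'w) \<Rightarrow> (int \<Rightarrow> 'w \<Rightarrow> 'w)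
    \<Rightarrow> (int \<Rightarrow> 'w \<Rightarrow> 'w) \<Rightarrow> int \<Rightarrow> 'a \<Rightarrow> 'w \<Rightarrow> 'w" where
  "op_C_right scale b c M x w = eventual_value (\<lambda>N.
     prod_desc (\<lambda>i. op_exp scale (\<lambda>u. scale x (c (i - 1) (b (- i + 2) u)))) M N w)"

end

theory Submission
  imports Defs
begin

text \<open>
  Put \<open>p j = b(-j)\<close> and \<open>q j = c(j)\<close>, so that \<open>{p i, q j} = \<delta>\<^sub>i\<^sub>j\<close>. Every exponent is then a hopping
  term \<open>p i q j\<close> between neighbouring sites \<open>i\<close> and \<open>j\<close>. Number the hopping terms that go in
  one direction as \<open>E i\<close>. Since a repeated \<open>p i\<close> or \<open>q j\<close> can be brought together and squares to
  zero, they satisfy the relations of the nil-Temperley-Lieb algebra: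
  \<open>E i E i = 0\<close>, \<open>E i E j E i = 0\<close>, and \<open>E i E j = E j E i\<close> for \<open>\<bar>i - j\<bar> > 1\<close>.

  Consequently each exponential is \<open>h i x = 1 + x E i\<close>, it is additive in \<open>x\<close>
  (\<open>h i x h i y = h i (x + y)\<close>), and neighbouring factors satisfy the Yang-Baxter equation
  \<open>h i x h (i + 1) (x + y) h i y = h (i + 1) y h i (x + y) h (i + 1) x\<close>. By the argument of Fomin
  and Kirillov, these properties alone force the finite descending products
  \<open>h M x h (M - 1) x \<dots> h (M - N + 1) x\<close> with different \<open>x\<close> to commute
  (\<open>prod_desc_commute\<close>). An ascending product is the inverse of the descending product at \<open>-x\<close>, so
  ascending products commute as well (\<open>prod_asc_commute\<close>).

  It remains to pass to the infinite products. Every vector obtained from the vacuum is killed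
  by \<open>p j\<close> for all sufficiently negative \<open>j\<close>, which makes the partial products on it eventually
  constant; the composite of two infinite products on a vector is then the composite of two partial
  products of the same sufficiently large length.

  On the dual Fock space the same holds with \<open>b\<close> and \<open>c\<close> interchanged: there \<open>p j = c(j)\<close> and
  \<open>q j = b(-j)\<close>, and the reversal of compositions turns the right action of \<open>\<^bold>B\<close> into an ascending
  product of terms \<open>p (i - 2) q (i - 1)\<close>, like \<open>\<^bold>C\<close> on the Fock space, and that of \<open>\<^bold>C\<close> into a
  descending one, like \<open>\<^bold>B\<close>.
\<close>

section \<open>Infinite ordered products\<close>

lemma eventual_value_eqI:
  assumes "\<And>N. N \<ge> N0 \<Longrightarrow> s N = u"
  shows "eventual_value s = u"
proof -
  have *: "\<forall>\<^sub>F N in sequentially. s N = u"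
    using assms by (auto simp: eventually_sequentially)
  show ?thesis
    unfolding eventual_value_def
  proof (rule the_equality)
    show "\<forall>\<^sub>F N in sequentially. s N = u" by (rule *)
  next
    fix u' assume "\<forall>\<^sub>F N in sequentially. s N = u'"
    with * have "\<forall>\<^sub>F N in sequentially. u' = u"
      by eventually_elim simp
    then show "u' = u" by simp
  qed
qed

lemma eventual_value_commute:
  assumes F: "\<And>v. \<exists>N0. \<forall>N\<ge>N0. F N v = F N0 v"
    and G: "\<And>v. \<exists>N0. \<forall>N\<ge>N0. G N v = G N0 v"
    and comm: "\<And>N v. F N (G N v) = G N (F N v)"
  shows "eventual_value (\<lambda>N. F N (eventual_value (\<lambda>N. G N v)))
    = eventual_value (\<lambda>N. G N (eventual_value (\<lambda>N. F N v)))"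
proof -
  obtain N1 where N1: "\<And>N. N \<ge> N1 \<Longrightarrow> F N v = F N1 v" using F[of v] by blast
  obtain N2 where N2: "\<And>N. N \<ge> N2 \<Longrightarrow> G N v = G N2 v" using G[of v] by blast
  obtain N3 where N3: "\<And>N. N \<ge> N3 \<Longrightarrow> F N (G N2 v) = F N3 (G N2 v)" using F by blast
  obtain N4 where N4: "\<And>N. N \<ge> N4 \<Longrightarrow> G N (F N1 v) = G N4 (F N1 v)" using G by blast
  define N where "N = Max {N1, N2, N3, N4}"
  have N: "N \<ge> N1" "N \<ge> N2" "N \<ge> N3" "N \<ge> N4" by (auto simp: N_def)
  have "F N3 (G N2 v) = F N (G N v)" using N N2 N3 by metis
  also have "\<dots> = G N (F N v)" by (rule comm)
  also have "\<dots> = G N4 (F N1 v)" using N N1 N4 by metis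
  finally show ?thesis
    using eventual_value_eqI[OF N1] eventual_value_eqI[OF N2]
      eventual_value_eqI[OF N3] eventual_value_eqI[OF N4]
    by simp
qed

lemma prod_desc_stable:
  assumes "\<And>i. i \<le> K \<Longrightarrow> f i v = v" and "N \<ge> nat (M - K)"
  shows "prod_desc f M N v = prod_desc f M (nat (M - K)) v"
  using assms(2) by (induction N rule: dec_induct) (simp_all add: assms(1))

lemma prod_asc_stable:
  assumes "\<And>i. i \<le> K \<Longrightarrow> f i (prod_asc f M (nat (M - K)) v) = prod_asc f M (nat (M - K)) v"
    and "N \<ge> nat (M - K)"
  shows "prod_asc f M N v = prod_asc f M (nat (M - K)) v"
  using assms(2) by (induction N rule: dec_induct) (simp_all add: assms(1))

section \<open>Commuting products from the Yang-Baxter equation\<close>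

locale nil_temperley_lieb = vector_space scale
  for scale :: "'a::field_char_0 \<Rightarrow> 'v::ab_group_add \<Rightarrow> 'v" (infixr "*s" 75) +
  fixes E :: "int \<Rightarrow> 'v \<Rightarrow> 'v"
  assumes E_add [simp]: "E i (u + v) = E i u + E i v"
    and E_scale [simp]: "E i (x *s v) = x *s E i v"
    and E_square [simp]: "E i (E i v) = 0"
    and E_sandwich [simp]: "E i (E j (E i v)) = 0"
    and E_commute: "\<bar>i - j\<bar> > 1 \<Longrightarrow> E i (E j v) = E j (E i v)"
begin

lemma E_zero [simp]: "E i 0 = 0"
  using E_scale[of i 0 0] by simp

definition h :: "int \<Rightarrow> 'a \<Rightarrow> 'v \<Rightarrow> 'v" where
  "h i x v = v + x *s E i v"

lemma op_exp_eq_h: "op_exp scale (\<lambda>u. x *s E i u) = h i x"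
proof
  fix v
  let ?A = "\<lambda>u. x *s E i u"
  let ?g = "\<lambda>n. (1 / fact n) *s (?A ^^ n) v"
  have "(?A ^^ (n + 2)) v = 0" for n
    by (induction n) (simp_all add: scale_scale)
  then have *: "?g n = 0" if "n \<ge> 2" for n
    using that le_Suc_ex[of 2 n] by (metis add.commute scale_zero_right)
  have sub: "{n. ?g n \<noteq> 0} \<subseteq> {0, 1}"
  proof
    fix n assume "n \<in> {n. ?g n \<noteq> 0}"
    with *[of n] have "n < 2" by force
    then show "n \<in> {0, 1}" by auto
  qed
  have "op_exp scale ?A v = Sum_any ?g" by (simp add: op_exp_def)
  also have "\<dots> = sum ?g {0, 1}"
    by (rule Sum_any.expand_superset[OF _ sub]) simp
  finally show "op_exp scale ?A v = h i x v" by (simp add: h_def)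
qed

lemma h_zero [simp]: "h i 0 v = v"
  by (simp add: h_def)

lemma h_h: "h i x (h i y v) = h i (x + y) v"
  by (simp add: h_def algebra_simps)

lemma h_commute: "\<bar>i - j\<bar> > 1 \<Longrightarrow> h i x (h j y v) = h j y (h i x v)"
  by (simp add: h_def E_commute[of i j] algebra_simps)

text \<open>
  Both sides equal \<open>1 + (x + y) (E i + E (i + 1)) + x (x + y) E i E (i + 1) + y (x + y) E (i + 1) E i\<close>.
\<close>

lemma yang_baxter:
  "h i x (h (i + 1) (x + y) (h i y v)) = h (i + 1) y (h i (x + y) (h (i + 1) x v))"
  by (simp add: h_def algebra_simps)

lemma h_prod_desc_commute:
  assumes "j < M - int N"
  shows "h j x (prod_desc (\<lambda>i. h i y) M N v) = prod_desc (\<lambda>i. h i y) M N (h j x v)"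
  using assms by (induction N arbitrary: v) (auto simp: h_commute[of j])

text \<open>
  The Yang-Baxter equation lets the last factor of the left product pass the last two factors of
  the right one; the exchange leaves a factor at the second-to-last site, which recombines so that
  the two shorter products meet and the induction hypothesis applies.
\<close>

lemma prod_desc_commute:
  "prod_desc (\<lambda>i. h i x) M N (prod_desc (\<lambda>i. h i y) M N v)
    = prod_desc (\<lambda>i. h i y) M N (prod_desc (\<lambda>i. h i x) M N v)"
proof (induction N arbitrary: v)
  case 0
  show ?case by simp
next
  case (Suc N)
  show ?case
  proof (cases N)
    case 0
    then show ?thesis by (simp add: h_h add.commute)
  next
    case (Suc n)
    define i where "i = M - int N"
    define A where "A z = prod_desc (\<lambda>i. h i z) M N" for z
    define B where "B z = prod_desc (\<lambda>i. h i z) M n" for z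
    have A: "A z u = B z (h (i + 1) z u)" for z u
      by (simp add: A_def B_def Suc i_def)
    have IH: "A x (A y u) = A y (A x u)" for u
      using Suc.IH by (simp add: A_def)
    have B_h: "h i w (B z u) = B z (h i w u)" for w z u
      unfolding B_def by (rule h_prod_desc_commute) (simp add: i_def Suc)
    have B_A: "B z u = A z (h (i + 1) (- z) u)" for z u
      by (simp add: A h_h)
    \<comment> \<open>Splitting \<open>h i y\<close> as \<open>h i (y - x) h i x\<close> makes the parameters fit the Yang-Baxter equation.\<close>
    have "A x (h i x (A y (h i y v)))
        = A x (B y (h i x (h (i + 1) y (h i (y - x) (h i x v)))))"
      by (simp add: A B_h h_h)
    also have "\<dots> = A x (B y (h (i + 1) (y - x) (h i y (h (i + 1) x (h i x v)))))"
      using yang_baxter[of i x "y - x"] by simp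
    also have "\<dots> = A x (A y (h (i + 1) (- x) (h i y (h (i + 1) x (h i x v)))))"
      by (simp add: B_A h_h)
    also have "\<dots> = A y (A x (h (i + 1) (- x) (h i y (h (i + 1) x (h i x v)))))"
      by (rule IH)
    also have "\<dots> = A y (B x (h i y (h (i + 1) x (h i x v))))"
      by (simp add: B_A)
    also have "\<dots> = A y (h i y (A x (h i x v)))"
      by (simp add: A B_h)
    finally show ?thesis by (simp add: A_def i_def)
  qed
qed

lemma prod_desc_prod_asc_inverse:
  "prod_desc (\<lambda>i. h i (- x)) M N (prod_asc (\<lambda>i. h i x) M N v) = v"
  by (induction N) (simp_all add: h_h)

lemma prod_asc_prod_desc_inverse:
  "prod_asc (\<lambda>i. h i x) M N (prod_desc (\<lambda>i. h i (- x)) M N v) = v"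
  by (induction N arbitrary: v) (simp_all add: h_h)

lemma prod_asc_commute:
  "prod_asc (\<lambda>i. h i x) M N (prod_asc (\<lambda>i. h i y) M N v)
    = prod_asc (\<lambda>i. h i y) M N (prod_asc (\<lambda>i. h i x) M N v)"
  by (metis prod_desc_commute prod_desc_prod_asc_inverse prod_asc_prod_desc_inverse)

end

section \<open>Hopping terms\<close>

text \<open>
  The modes are indexed so that \<open>p i\<close> is conjugate to \<open>q i\<close>. The module is generated by a vector on
  which \<open>p j\<close> vanishes for all sufficiently negative \<open>j\<close>; this covers the Fock space and, with the two kinds
  of fermions interchanged, its dual.
\<close>

locale bounded_modes = vector_space scale
  for scale :: "'a::field_char_0 \<Rightarrow> 'v::ab_group_add \<Rightarrow> 'v" (infixr "*s" 75) +
  fixes p q :: "int \<Rightarrow> 'v \<Rightarrow> 'v" and vac :: 'v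
  assumes linear_p: "Vector_Spaces.linear scale scale (p i)"
    and linear_q: "Vector_Spaces.linear scale scale (q i)"
    and anticomm_pq: "p i (q j v) + q j (p i v) = (if i = j then v else 0)"
    and anticomm_pp: "p i (p j v) + p j (p i v) = 0"
    and anticomm_qq: "q i (q j v) + q j (q i v) = 0"
    and p_vac: "\<exists>K. \<forall>j\<le>K. p j vac = 0"
    and generates: "subspace S \<Longrightarrow> vac \<in> S \<Longrightarrow>
      (\<And>i v. v \<in> S \<Longrightarrow> p i v \<in> S) \<Longrightarrow> (\<And>i v. v \<in> S \<Longrightarrow> q i v \<in> S) \<Longrightarrow> S = UNIV"
begin

sublocale P: Vector_Spaces.linear scale scale "p i" for i by (rule linear_p)
sublocale Q: Vector_Spaces.linear scale scale "q i" for i by (rule linear_q)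

lemma double_eq_zeroD:
  assumes "v + v = (0::'v)"
  shows "v = 0"
proof -
  have "2 *s v = v + v"
    by (metis one_add_one scale_left_distrib scale_one)
  with assms show ?thesis by simp
qed

lemma p_square [simp]: "p i (p i v) = 0"
  by (rule double_eq_zeroD[OF anticomm_pp])

lemma q_square [simp]: "q i (q i v) = 0"
  by (rule double_eq_zeroD[OF anticomm_qq])

lemma p_p: "p i (p j v) = - p j (p i v)"
  using anticomm_pp[of i j v] by (simp add: eq_neg_iff_add_eq_0)

lemma q_q: "q i (q j v) = - q j (q i v)"
  using anticomm_qq[of i j v] by (simp add: eq_neg_iff_add_eq_0)

lemma p_q: "i \<noteq> j \<Longrightarrow> p i (q j v) = - q j (p i v)"
  using anticomm_pq[of i j v] by (simp add: eq_neg_iff_add_eq_0)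

lemma q_p: "i \<noteq> j \<Longrightarrow> q i (p j v) = - p j (q i v)"
  using p_q[of j i v] by simp

definition hop :: "int \<Rightarrow> int \<Rightarrow> 'v \<Rightarrow> 'v" where
  "hop i j v = p i (q j v)"

lemma p_hop: "k \<noteq> j \<Longrightarrow> p k (hop i j v) = hop i j (p k v)"
  by (simp add: hop_def p_p[of k i] p_q[of k j] P.neg)

lemma q_hop: "k \<noteq> i \<Longrightarrow> q k (hop i j v) = hop i j (q k v)"
  by (simp add: hop_def q_p[of k i] q_q[of k j] P.neg)

lemma hop_add: "hop i j (u + v) = hop i j u + hop i j v"
  by (simp add: hop_def P.add Q.add)

lemma hop_scale: "hop i j (x *s v) = x *s hop i j v"
  by (simp add: hop_def P.scale Q.scale)

lemma hop_zero [simp]: "hop i j 0 = 0"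
  by (simp add: hop_def)

lemma hop_commute:
  assumes "i \<noteq> l" "j \<noteq> k"
  shows "hop i j (hop k l v) = hop k l (hop i j v)"
  using assms by (metis hop_def p_hop q_hop)

lemma hop_p [simp]: "i \<noteq> j \<Longrightarrow> hop i j (p i v) = 0"
  by (simp add: hop_def q_p P.neg)

lemma hop_square: "i \<noteq> j \<Longrightarrow> hop i j (hop i j v) = 0"
  by (metis hop_def hop_p)

lemma hop_sandwich:
  assumes "i \<noteq> j" "i \<noteq> l \<or> j \<noteq> k"
  shows "hop i j (hop k l (hop i j v)) = 0"
  using assms(2)
proof
  assume "i \<noteq> l"
  then have "hop k l (hop i j v) = p i (hop k l (q j v))"
    by (simp add: p_hop hop_def[of i j])
  with assms(1) show ?thesis by simp
next
  assume "j \<noteq> k"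
  then have "q j (hop k l (hop i j v)) = hop k l (q j (hop i j v))"
    by (rule q_hop)
  also have "\<dots> = 0" using assms(1) by (simp add: hop_def[of i j] q_p)
  finally show ?thesis by (simp add: hop_def[of i j "hop k l _"])
qed

lemma nil_temperley_lieb_up: "nil_temperley_lieb scale (\<lambda>i. hop (i - 1) (i - 2))"
  by unfold_locales (auto simp: hop_add hop_scale intro!: hop_square hop_sandwich hop_commute)

lemma nil_temperley_lieb_down: "nil_temperley_lieb scale (\<lambda>i. hop (i - 2) (i - 1))"
  by unfold_locales (auto simp: hop_add hop_scale intro!: hop_square hop_sandwich hop_commute)

text \<open>A mode \<open>q i\<close> can revive only \<open>p i\<close>, so it merely lowers the bound \<open>K\<close> below \<open>i\<close>.\<close>

lemma p_eventually_zero: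
  obtains K where "\<And>j. j \<le> K \<Longrightarrow> p j v = 0"
proof -
  define S where "S = {v. \<exists>K. \<forall>j\<le>K. p j v = 0}"
  have "S = UNIV"
  proof (rule generates)
    show "subspace S"
    proof (rule subspaceI)
      show "0 \<in> S" by (simp add: S_def)
    next
      fix u v assume "u \<in> S" "v \<in> S"
      then obtain K L where "\<forall>j\<le>K. p j u = 0" "\<forall>j\<le>L. p j v = 0"
        by (auto simp: S_def)
      then have "\<forall>j\<le>min K L. p j (u + v) = 0" by (simp add: P.add)
      then show "u + v \<in> S" unfolding S_def by blast
    next
      fix x v assume "v \<in> S"
      then show "x *s v \<in> S" by (auto simp: S_def P.scale)
    qed
    show "vac \<in> S" using p_vac by (simp add: S_def)
  next
    fix i v assume "v \<in> S"
    then obtain K where K: "\<forall>j\<le>K. p j v = 0" by (auto simp: S_def)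
    then have "\<forall>j\<le>K. p j (p i v) = 0" by (simp add: p_p[of _ i])
    then show "p i v \<in> S" unfolding S_def by blast
    from K have "\<forall>j\<le>min K (i - 1). p j (q i v) = 0" by (simp add: p_q)
    then show "q i v \<in> S" unfolding S_def by blast
  qed
  then show thesis using that by (auto simp: S_def)
qed

text \<open>
  Descending products let the factors with small \<open>i\<close> act first, so it suffices that these
  are the identity on the given vector.
\<close>

lemma prod_desc_up_commute:
  defines "U \<equiv> \<lambda>M x v. eventual_value (\<lambda>N.
    prod_desc (\<lambda>i. op_exp scale (\<lambda>u. x *s p (i - 1) (q (i - 2) u))) M N v)"
  shows "U M x \<circ> U M y = U M y \<circ> U M x"
proof -
  interpret T: nil_temperley_lieb scale "\<lambda>i. hop (i - 1) (i - 2)"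
    by (rule nil_temperley_lieb_up)
  have U: "U M z = (\<lambda>v. eventual_value (\<lambda>N. prod_desc (\<lambda>i. T.h i z) M N v))" for z
    unfolding U_def hop_def[symmetric] T.op_exp_eq_h ..
  have stable: "\<exists>N0. \<forall>N\<ge>N0. prod_desc (\<lambda>i. T.h i z) M N v = prod_desc (\<lambda>i. T.h i z) M N0 v"
    for z v
  proof -
    obtain K where K: "\<And>j. j \<le> K \<Longrightarrow> p j v = 0" using p_eventually_zero by blast
    have "T.h i z v = v" if "i \<le> K" for i
      using K[of "i - 1"] that by (simp add: T.h_def hop_def p_q)
    then show ?thesis using prod_desc_stable[of K "\<lambda>i. T.h i z" v] by blast
  qed
  show ?thesis
    unfolding U comp_def
    by (rule ext, rule eventual_value_commute[where F = "prod_desc (\<lambda>i. T.h i x) M"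
          and G = "prod_desc (\<lambda>i. T.h i y) M"])
      (rule stable T.prod_desc_commute)+
qed

text \<open>
  Ascending products let the factors with small \<open>i\<close> act last, on a vector that depends on all the
  earlier factors. If \<open>p j\<close> kills the initial vector for \<open>j \<le> K\<close>, the earlier factors, with
  \<open>i - 1 > K\<close>, preserve this, since \<open>q (i - 1)\<close> anticommutes with these \<open>p j\<close>. In the remaining
  factors \<open>p (i - 2)\<close> is one of these \<open>p j\<close>, which makes them the identity.
\<close>

lemma prod_asc_down_commute:
  defines "D \<equiv> \<lambda>M x v. eventual_value (\<lambda>N.
    prod_asc (\<lambda>i. op_exp scale (\<lambda>u. x *s p (i - 2) (q (i - 1) u))) M N v)"
  shows "D M x \<circ> D M y = D M y \<circ> D M x"
proof -
  interpret T: nil_temperley_lieb scale "\<lambda>i. hop (i - 2) (i - 1)"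
    by (rule nil_temperley_lieb_down)
  have D: "D M z = (\<lambda>v. eventual_value (\<lambda>N. prod_asc (\<lambda>i. T.h i z) M N v))" for z
    unfolding D_def hop_def[symmetric] T.op_exp_eq_h ..
  have stable: "\<exists>N0. \<forall>N\<ge>N0. prod_asc (\<lambda>i. T.h i z) M N v = prod_asc (\<lambda>i. T.h i z) M N0 v"
    for z v
  proof -
    obtain K where K: "\<And>j. j \<le> K \<Longrightarrow> p j v = 0" using p_eventually_zero by blast
    define w where "w = prod_asc (\<lambda>i. T.h i z) M (nat (M - (K + 1))) v"
    have "\<forall>j\<le>K. p j (prod_asc (\<lambda>i. T.h i z) M N v) = 0" if "N \<le> nat (M - (K + 1))" for N
      using that
    proof (induction N)
      case 0
      then show ?case using K by simp
    next
      case (Suc N)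
      then have "M - int N - 1 > K" by linarith
      with Suc show ?case
        by (auto simp: T.h_def P.add P.scale p_hop)
    qed
    then have w: "p j w = 0" if "j \<le> K" for j
      using that by (simp add: w_def)
    have "T.h i z w = w" if "i \<le> K + 1" for i
      using w[of "i - 2"] that by (simp add: T.h_def hop_def p_q)
    then show ?thesis
      using prod_asc_stable[of "K + 1" "\<lambda>i. T.h i z" M v] unfolding w_def by blast
  qed
  show ?thesis
    unfolding D comp_def
    by (rule ext, rule eventual_value_commute[where F = "prod_asc (\<lambda>i. T.h i x) M"
          and G = "prod_asc (\<lambda>i. T.h i y) M"])
      (rule stable T.prod_asc_commute)+
qed

end

section \<open>The Fock space and its dual\<close>

lemma fock_space_bounded_modes:
  assumes "fock_space scale b c vac"
  shows "bounded_modes scale (\<lambda>j. b (- j)) c vac"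
proof -
  interpret fock_space scale b c vac by (rule assms)
  show ?thesis
  proof (intro bounded_modes.intro bounded_modes_axioms.intro)
    show "b (- i) (c j v) + c j (b (- i) v) = (if i = j then v else 0)" for i j v
      by (simp add: anticomm_bc)
    have "\<forall>j\<le>-1. b (- j) vac = 0"
      using b_vac[of "- j - 1" for j] by simp
    then show "\<exists>K. \<forall>j\<le>K. b (- j) vac = 0" by blast
    show "S = UNIV" if "subspace S" "vac \<in> S"
      "\<And>i v. v \<in> S \<Longrightarrow> b (- i) v \<in> S" "\<And>i v. v \<in> S \<Longrightarrow> c i v \<in> S" for S
    proof (rule vac_generates[OF that(1,2) _ that(4)])
      show "b i v \<in> S" if "v \<in> S" for i v
        using \<open>\<And>i v. v \<in> S \<Longrightarrow> b (- i) v \<in> S\<close>[of v "- i"] that by simp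
    qed
  qed (rule vector_space_axioms linear_b linear_c anticomm_bb anticomm_cc)+
qed

lemma dual_fock_space_bounded_modes:
  assumes "dual_fock_space scale b c covac"
  shows "bounded_modes scale c (\<lambda>j. b (- j)) covac"
proof -
  interpret dual_fock_space scale b c covac by (rule assms)
  show ?thesis
  proof (intro bounded_modes.intro bounded_modes_axioms.intro)
    show "c i (b (- j) v) + b (- j) (c i v) = (if i = j then v else 0)" for i j v
      using anticomm_bc[of "- j" i v] by (auto simp: add.commute)
    have "\<forall>j\<le>-1. c j covac = 0"
      using covac_c by simp
    then show "\<exists>K. \<forall>j\<le>K. c j covac = 0" by blast
    show "S = UNIV" if "subspace S" "covac \<in> S"
      "\<And>i v. v \<in> S \<Longrightarrow> c i v \<in> S" "\<And>i v. v \<in> S \<Longrightarrow> b (- i) v \<in> S" for S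
    proof (rule covac_generates[OF that(1,2) _ that(3)])
      show "b i v \<in> S" if "v \<in> S" for i v
        using \<open>\<And>i v. v \<in> S \<Longrightarrow> b (- i) v \<in> S\<close>[of v "- i"] that by simp
    qed
  qed (rule vector_space_axioms linear_b linear_c anticomm_bb anticomm_cc)+
qed

theorem proposition2p2:
  fixes scale :: "'a::field_char_0 \<Rightarrow> 'v::ab_group_add \<Rightarrow> 'v"
    and b c :: "int \<Rightarrow> 'v \<Rightarrow> 'v" and vac :: 'v
    and scale' :: "'a \<Rightarrow> 'w::ab_group_add \<Rightarrow> 'w"
    and b' c' :: "int \<Rightarrow> 'w \<Rightarrow> 'w" and covac :: 'w
    and M :: int and x y :: 'a
  assumes "fock_space scale b c vac"
    and "dual_fock_space scale' b' c' covac"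
    and "M > 0"
  shows "op_B scale b c M x \<circ> op_B scale b c M y = op_B scale b c M y \<circ> op_B scale b c M x
    \<and> op_C scale b c M x \<circ> op_C scale b c M y = op_C scale b c M y \<circ> op_C scale b c M x
    \<and> op_B_right scale' b' c' M y \<circ> op_B_right scale' b' c' M x
        = op_B_right scale' b' c' M x \<circ> op_B_right scale' b' c' M y
    \<and> op_C_right scale' b' c' M y \<circ> op_C_right scale' b' c' M x
        = op_C_right scale' b' c' M x \<circ> op_C_right scale' b' c' M y"
proof -
  interpret F: bounded_modes scale "\<lambda>j. b (- j)" c vac
    by (rule fock_space_bounded_modes) (rule assms)
  interpret D: bounded_modes scale' c' "\<lambda>j. b' (- j)" covac
    by (rule dual_fock_space_bounded_modes) (rule assms)
  have index: "- i + 2 = - (i - 2)" for i :: int by simp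
  show ?thesis
    unfolding op_B_def[abs_def] op_C_def[abs_def] op_B_right_def[abs_def] op_C_right_def[abs_def]
      index
    by (intro conjI F.prod_desc_up_commute F.prod_asc_down_commute
        D.prod_desc_up_commute D.prod_asc_down_commute)
qed

end
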